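(* Let $\mathcal{H}$ be a complex Hilbert space, let $V\in\mathcal{I}(\mathcal{H})$ be a partial isometry and let $v\in (T\mathcal{I}(\mathcal{H}))_V$ be a tangent vector at $V$. Then $$|v|_V\le \|v\|\le 2\,|v|_V ,$$ where $\|v\|$ is the operator norm of $v\in\mathcal{B}(\mathcal{H})$ and $|v|_V$ is the quotient Finsler norm.
   Context: $\mathcal{B}(\mathcal{H})$ denotes the bounded linear operators on $\mathcal{H}$, and $\mathcal{I}(\mathcal{H})=\{V\in\mathcal{B}(\mathcal{H}): VV^*V=V\}$ is the set of partial isometries. The tangent space of $\mathcal{I}(\mathcal{H})$ at $V$ is $$(T\mathcal{I}(\mathcal{H}))_V=\{iXV-iVY: X,Y\in\mathcal{B}(\mathcal{H}),\ X^*=X,\ Y^*=Y\}\subset\mathcal{B}(\mathcal{H}).$$ The Finsler norm on it is $$|v|_V=\inf\{\max\{\|A\|,\|B\|\}: A,B\in\mathcal{B}(\mathcal{H}),\ A^*=A,\ B^*=B,\ iAV-iVB=v\}.$$ *)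

theory Defs
  imports "HOL-Analysis.Analysis"
begin

text \<open>
  Complex Hilbert spaces, built on the library's class of real Banach spaces so that norm,
  completeness, \<^const>\<open>bounded_linear\<close> and \<^const>\<open>onorm\<close> are the library's own.
  The inner product is linear in its first argument.
\<close>

class complex_hilbert_space = banach +
  fixes scaleC :: "complex \<Rightarrow> 'a \<Rightarrow> 'a" (infixr "*\<^sub>C" 75)
    and cinner :: "'a \<Rightarrow> 'a \<Rightarrow> complex"
  assumes scaleC_add_right: "c *\<^sub>C (x + y) = c *\<^sub>C x + c *\<^sub>C y"
    and scaleC_add_left: "(c + d) *\<^sub>C x = c *\<^sub>C x + d *\<^sub>C x"
    and scaleC_scaleC: "c *\<^sub>C d *\<^sub>C x = (c * d) *\<^sub>C x"
    and scaleC_one: "1 *\<^sub>C x = x"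
    and scaleR_scaleC: "r *\<^sub>R x = complex_of_real r *\<^sub>C x"
    and cinner_add_left: "cinner (x + y) z = cinner x z + cinner y z"
    and cinner_scaleC_left: "cinner (c *\<^sub>C x) y = c * cinner x y"
    and cinner_commute: "cinner x y = cnj (cinner y x)"
    and cinner_ge_zero: "0 \<le> Re (cinner x x)"
    and cinner_eq_zero_iff: "cinner x x = 0 \<longleftrightarrow> x = 0"
    and norm_eq_sqrt_cinner: "norm x = sqrt (Re (cinner x x))"

instantiation complex :: complex_hilbert_space
begin

definition scaleC_complex :: "complex \<Rightarrow> complex \<Rightarrow> complex"
  where "scaleC_complex c x = c * x"

definition cinner_complex :: "complex \<Rightarrow> complex \<Rightarrow> complex"
  where "cinner_complex x y = x * cnj y"

instance
  by standard
    (simp_all add: scaleC_complex_def cinner_complex_def algebra_simps scaleR_conv_of_real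
      cmod_def power2_eq_square)

end

definition bounded_operators :: "('a::complex_hilbert_space \<Rightarrow> 'a) set"
  where "bounded_operators =
    {A. bounded_linear A \<and> (\<forall>c x. A (c *\<^sub>C x) = c *\<^sub>C A x)}"

text \<open>
  The description is unique by definiteness of the inner product
  and, for \<open>A \<in> bounded_operators\<close>, exists by the Riesz representation theorem.
\<close>

definition cadjoint ::
    "('a::complex_hilbert_space \<Rightarrow> 'a) \<Rightarrow> 'a \<Rightarrow> 'a"
  where "cadjoint A = (THE B. \<forall>x y. cinner (A x) y = cinner x (B y))"

definition partial_isometries :: "('a::complex_hilbert_space \<Rightarrow> 'a) set"
  where "partial_isometries = {V \<in> bounded_operators. V \<circ> cadjoint V \<circ> V = V}"

definition selfadjoint_operators :: "('a::complex_hilbert_space \<Rightarrow> 'a) set"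
  where "selfadjoint_operators = {A \<in> bounded_operators. cadjoint A = A}"

definition tangent_space ::
    "('a::complex_hilbert_space \<Rightarrow> 'a) \<Rightarrow> ('a \<Rightarrow> 'a) set"
  where "tangent_space V =
    {(\<lambda>x. \<i> *\<^sub>C X (V x) - \<i> *\<^sub>C V (Y x)) | X Y.
       X \<in> selfadjoint_operators \<and> Y \<in> selfadjoint_operators}"

text \<open>
  The infimum is over a nonempty set, bounded below by \<open>0\<close>, exactly when
  \<open>v \<in> tangent_space V\<close>; elsewhere the value is meaningless.
\<close>

definition finsler_norm ::
    "('a::complex_hilbert_space \<Rightarrow> 'a) \<Rightarrow> ('a \<Rightarrow> 'a) \<Rightarrow> real"
  where "finsler_norm V v =
    Inf {max (onorm A) (onorm B) | A B.
       A \<in> selfadjoint_operators \<and> B \<in> selfadjoint_operators \<and>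
       (\<lambda>x. \<i> *\<^sub>C A (V x) - \<i> *\<^sub>C V (B x)) = v}"

end

theory Submission
  imports Defs
begin

text \<open>
  Put \<open>w = X V - V Y\<close>, so that \<open>v = \<i> w\<close> and \<open>w\<close> has the same operator norm as \<open>v\<close>.
  Every lift \<open>A V - V B = w\<close> satisfies \<open>\<parallel>v\<parallel> \<le> \<parallel>A\<parallel> + \<parallel>B\<parallel>\<close>, since a partial isometry is a
  contraction; this is the upper bound on \<open>\<parallel>v\<parallel>\<close>.

  For the lower bound, a lift with \<open>\<parallel>A\<parallel>, \<parallel>B\<parallel> \<le> m\<close> is needed for each \<open>m > \<parallel>v\<parallel>\<close>. With
  \<open>P = V\<^sup>* V\<close> and \<open>Q = V V\<^sup>*\<close>, the operator \<open>w\<close> has three blocks. The block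
  \<open>(1 - Q) w P\<close> determines \<open>(1 - Q) A Q\<close>, the block \<open>Q w (1 - P)\<close> determines
  \<open>P B (1 - P)\<close>, and \<open>Q w P\<close> only determines the difference of the diagonal blocks
  \<open>Q A Q\<close> and \<open>P B P\<close>, transported to each other by \<open>V\<close>. The remaining corners are free.
  Sharing \<open>Q w P\<close> equally between \<open>A\<close> and \<open>B\<close> prescribes for each of them a column
  \<open>(a, c)\<close> for which even \<open>(2a, c)\<close> is bounded by \<open>m\<close>, being a column of \<open>w\<close> or of
  \<open>w\<^sup>*\<close>. The factor \<open>2\<close> leaves enough room to fill in the free corner by the explicit operator
  \<open>- c a c\<^sup>* / m\<^sup>2\<close> without exceeding the norm \<open>m\<close>; this is
  \<open>selfadjoint_completion_norm_le\<close>, and \<open>half_lift\<close> and \<open>tangent_lift\<close> assemble the lift.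
\<close>

section \<open>Inner product calculus\<close>

lemma cinner_add_right:
  "cinner x (y + z) = cinner x y + cinner x (z::'a::complex_hilbert_space)"
  by (metis cinner_add_left cinner_commute complex_cnj_add)

lemma cinner_scaleC_right:
  "cinner x (c *\<^sub>C y) = cnj c * cinner x (y::'a::complex_hilbert_space)"
  by (metis cinner_scaleC_left cinner_commute complex_cnj_mult)

lemma cinner_scaleR_left:
  "cinner (r *\<^sub>R x) y = of_real r * cinner x (y::'a::complex_hilbert_space)"
  by (simp add: scaleR_scaleC cinner_scaleC_left)

lemma cinner_scaleR_right:
  "cinner x (r *\<^sub>R y) = of_real r * cinner x (y::'a::complex_hilbert_space)"
  by (simp add: scaleR_scaleC cinner_scaleC_right)

lemma cinner_minus_left: "cinner (- x) y = - cinner x (y::'a::complex_hilbert_space)"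
  using cinner_scaleR_left[of "-1" x y] by simp

lemma cinner_minus_right: "cinner x (- y) = - cinner x (y::'a::complex_hilbert_space)"
  using cinner_scaleR_right[of x "-1" y] by simp

lemma cinner_diff_left:
  "cinner (x - y) z = cinner x z - cinner y (z::'a::complex_hilbert_space)"
  using cinner_add_left[of x "- y" z] by (simp add: cinner_minus_left)

lemma cinner_diff_right:
  "cinner x (y - z) = cinner x y - cinner x (z::'a::complex_hilbert_space)"
  using cinner_add_right[of x y "- z"] by (simp add: cinner_minus_right)

lemmas cinner_simps = cinner_add_left cinner_add_right cinner_diff_left cinner_diff_right
  cinner_scaleR_left cinner_scaleR_right

lemma Re_cinner_commute: "Re (cinner x y) = Re (cinner y (x::'a::complex_hilbert_space))"
  by (subst cinner_commute) simp

lemma power2_norm_eq_cinner: "(norm x)\<^sup>2 = Re (cinner x (x::'a::complex_hilbert_space))"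
  by (simp add: norm_eq_sqrt_cinner cinner_ge_zero)

lemma power2_norm_add:
  "(norm (x + y))\<^sup>2 =
    (norm x)\<^sup>2 + (norm y)\<^sup>2 + 2 * Re (cinner x (y::'a::complex_hilbert_space))"
  using Re_cinner_commute[of x y] by (simp add: power2_norm_eq_cinner cinner_simps)

lemma power2_norm_diff:
  "(norm (x - y))\<^sup>2 =
    (norm x)\<^sup>2 + (norm y)\<^sup>2 - 2 * Re (cinner x (y::'a::complex_hilbert_space))"
  using Re_cinner_commute[of x y] by (simp add: power2_norm_eq_cinner cinner_simps)

text \<open>
  The triangle inequality is already part of the class, so the Cauchy--Schwarz inequality
  follows by squaring it.
\<close>

lemma Re_cinner_le: "Re (cinner x y) \<le> norm x * norm (y::'a::complex_hilbert_space)"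
proof -
  have "(norm (x + y))\<^sup>2 \<le> (norm x + norm y)\<^sup>2"
    by (simp add: norm_triangle_ineq power_mono)
  then show ?thesis by (simp add: power2_norm_add power2_sum)
qed

lemma abs_Re_cinner_le: "\<bar>Re (cinner x y)\<bar> \<le> norm x * norm (y::'a::complex_hilbert_space)"
  using Re_cinner_le[of x y] Re_cinner_le[of "- x" y] by (simp add: cinner_minus_left)

lemma cinner_eqI:
  assumes "\<And>x. cinner x y = cinner x (z::'a::complex_hilbert_space)"
  shows "y = z"
proof -
  have "cinner (y - z) (y - z) = 0"
    by (simp add: cinner_diff_right[of "y - z"] assms)
  then show ?thesis by (simp add: cinner_eq_zero_iff)
qed

lemma norm_scaleC_ii: "norm (\<i> *\<^sub>C x) = norm (x::'a::complex_hilbert_space)"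
  by (simp add: norm_eq_sqrt_cinner cinner_scaleC_left cinner_scaleC_right)

section \<open>Riesz representation and adjoints\<close>

text \<open>
  The representing vector is the minimiser of \<open>F x = \<parallel>x\<parallel>\<^sup>2 - 2 g x\<close>. The parallelogram law
  makes every minimising sequence Cauchy, and stationarity of \<open>F\<close> at the limit in each
  direction is the asserted identity.
\<close>

lemma riesz_representation_real:
  fixes g :: "'a::complex_hilbert_space \<Rightarrow> real"
  assumes g: "bounded_linear g"
  shows "\<exists>z. \<forall>x. g x = Re (cinner x z)"
proof -
  interpret bounded_linear g by (rule g)
  define F where "F x = (norm x)\<^sup>2 - 2 * g x" for x
  define m where "m = (INF x. F x)"
  have lower: "- (onorm g)\<^sup>2 \<le> F x" for x
  proof -
    have "g x \<le> onorm g * norm x"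
      using onorm[OF g, of x] by simp
    moreover have "0 \<le> (norm x - onorm g)\<^sup>2" by simp
    ultimately show ?thesis
      unfolding F_def power2_diff by (simp add: mult.commute mult.assoc)
  qed
  then have bdd: "bdd_below (range F)" by (rule bdd_belowI2)
  have m_le: "m \<le> F x" for x
    unfolding m_def by (rule cINF_lower[OF bdd]) simp
  have "\<exists>x. F x < m + inverse (real (Suc n))" for n
  proof -
    have "m < m + inverse (real (Suc n))" by simp
    then show ?thesis unfolding m_def using cINF_less_iff[OF UNIV_not_empty bdd] by blast
  qed
  then obtain s where s: "\<And>n. F (s n) < m + inverse (real (Suc n))" by metis
  have gap: "(norm (x - y))\<^sup>2 \<le> 2 * (F x - m) + 2 * (F y - m)" for x y
  proof -
    have "(norm ((1/2) *\<^sub>R (x + y)))\<^sup>2 = (norm (x + y))\<^sup>2 / 4"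
      by (simp add: power_divide)
    then have "4 * F ((1/2) *\<^sub>R (x + y)) = (norm (x + y))\<^sup>2 - 4 * g x - 4 * g y"
      unfolding F_def scaleR add by (simp add: field_simps)
    then show ?thesis
      using m_le[of "(1/2) *\<^sub>R (x + y)"]
      by (simp add: F_def power2_norm_add power2_norm_diff)
  qed
  have "Cauchy s"
  proof (rule metric_CauchyI)
    fix e :: real assume "0 < e"
    then obtain N where N: "inverse (real (Suc N)) < e\<^sup>2 / 4"
      using reals_Archimedean[of "e\<^sup>2 / 4"] by auto
    have close: "F (s n) - m < e\<^sup>2 / 4" if "N \<le> n" for n
    proof -
      have "inverse (real (Suc n)) \<le> inverse (real (Suc N))"
        using that by (intro le_imp_inverse_le) auto
      then show ?thesis using s[of n] N by linarith
    qed
    show "\<exists>N. \<forall>i\<ge>N. \<forall>j\<ge>N. dist (s i) (s j) < e"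
    proof (intro exI allI impI)
      fix i j assume "N \<le> i" "N \<le> j"
      then have "(norm (s i - s j))\<^sup>2 < e\<^sup>2"
        using gap[of "s i" "s j"] close[OF \<open>N \<le> i\<close>] close[OF \<open>N \<le> j\<close>] by argo
      then show "dist (s i) (s j) < e"
        using \<open>0 < e\<close> by (simp add: dist_norm power2_less_imp_less)
    qed
  qed
  then obtain z where z: "s \<longlonglongrightarrow> z"
    using Cauchy_convergent convergent_def by blast
  have "(\<lambda>n. F (s n)) \<longlonglongrightarrow> F z"
    unfolding F_def by (intro tendsto_intros z tendsto)
  moreover have "(\<lambda>n. m + inverse (real (Suc n))) \<longlonglongrightarrow> m + 0"
    by (intro tendsto_intros LIMSEQ_inverse_real_of_nat)
  ultimately have "F z \<le> m + 0"
    by (rule LIMSEQ_le) (use s less_imp_le in blast)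
  then have min: "F z \<le> F x" for x
    using m_le[of x] by simp
  have half: "g h \<le> Re (cinner h z)" for h
  proof (rule ccontr)
    assume less: "\<not> g h \<le> Re (cinner h z)"
    define d where "d = g h - Re (cinner h z)"
    have "0 < d" using less by (simp add: d_def)
    have quad: "2 * t * d \<le> t\<^sup>2 * (norm h)\<^sup>2" for t
    proof -
      have "F (z + t *\<^sub>R h) = F z + t\<^sup>2 * (norm h)\<^sup>2 - 2 * t * d"
        unfolding F_def d_def add scaleR power2_norm_add
        by (simp add: power_mult_distrib cinner_scaleR_right Re_cinner_commute[of z h]
            algebra_simps)
      then show ?thesis using min[of "z + t *\<^sub>R h"] by simp
    qed
    \<comment> \<open>A step \<open>t > 0\<close> with \<open>t \<parallel>h\<parallel>\<^sup>2 < 2 d\<close> violates \<open>quad\<close>; the summand \<open>1\<close> covers \<open>h = 0\<close>.\<close>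
    define t where "t = d / ((norm h)\<^sup>2 + 1)"
    have "0 < t" using \<open>0 < d\<close> by (simp add: t_def add_nonneg_pos)
    have "t * ((norm h)\<^sup>2 + 1) = d"
      by (simp add: t_def add_nonneg_eq_0_iff)
    moreover have "2 * d \<le> t * (norm h)\<^sup>2"
      using quad[of t] \<open>0 < t\<close> by (simp add: power2_eq_square)
    ultimately show False using \<open>0 < t\<close> \<open>0 < d\<close> by (simp add: algebra_simps)
  qed
  have "g h = Re (cinner h z)" for h
    using half[of h] half[of "- h"] by (simp add: neg cinner_minus_left)
  then show ?thesis by blast
qed

text \<open>
  A relation between an operator and its adjoint composes along sums and products, so adjoints
  of composite expressions are found by backward reasoning, with no appeal to the definite
  description in \<^const>\<open>cadjoint\<close>.
\<close>

definition adjoint_pair ::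
    "('a::complex_hilbert_space \<Rightarrow> 'a) \<Rightarrow> ('a \<Rightarrow> 'a) \<Rightarrow> bool"
  where "adjoint_pair A B \<longleftrightarrow>
    A \<in> bounded_operators \<and> B \<in> bounded_operators \<and>
    (\<forall>x y. cinner (A x) y = cinner x (B y))"

lemma adjoint_pairD: "adjoint_pair A B \<Longrightarrow> cinner (A x) y = cinner x (B y)"
  by (simp add: adjoint_pair_def)

lemma adjoint_pair_bounded_linear:
  assumes "adjoint_pair A B"
  shows "bounded_linear A" "bounded_linear B"
  using assms by (auto simp: adjoint_pair_def bounded_operators_def)

lemma adjoint_pair_sym:
  assumes "adjoint_pair A B" shows "adjoint_pair B A"
  using assms unfolding adjoint_pair_def by (metis cinner_commute)

lemma adjoint_pair_cadjoint_eq: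
  assumes "adjoint_pair A B" shows "cadjoint A = B"
  unfolding cadjoint_def
proof (rule the_equality)
  show "\<forall>x y. cinner (A x) y = cinner x (B y)"
    using assms by (simp add: adjoint_pair_def)
next
  fix C assume "\<forall>x y. cinner (A x) y = cinner x (C y)"
  then show "C = B"
    using assms by (metis adjoint_pairD cinner_eqI ext)
qed

text \<open>
  A bound \<open>K\<close> for \<open>A\<close> bounds any formal adjoint \<open>B\<close> as well, because
  \<open>\<parallel>B y\<parallel>\<^sup>2 = \<langle>A (B y), y\<rangle> \<le> K \<parallel>B y\<parallel> \<parallel>y\<parallel>\<close>.
\<close>

lemma formal_adjoint_norm_le:
  fixes A B :: "'a::complex_hilbert_space \<Rightarrow> 'a"
  assumes adj: "\<And>x y. cinner (A x) y = cinner x (B y)"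
    and bound: "\<And>x. norm (A x) \<le> K * norm x"
  shows "norm (B y) \<le> K * norm y"
proof (cases "B y = 0")
  case True
  have "0 \<le> K * norm y" using bound[of y] norm_ge_zero order_trans by blast
  then show ?thesis using True by simp
next
  case False
  have "(norm (B y))\<^sup>2 = Re (cinner (A (B y)) y)"
    by (simp add: power2_norm_eq_cinner adj)
  also have "\<dots> \<le> norm (A (B y)) * norm y" by (rule Re_cinner_le)
  also have "\<dots> \<le> (K * norm (B y)) * norm y"
    by (intro mult_right_mono bound) simp
  finally show ?thesis using False by (simp add: power2_eq_square mult.commute mult.left_commute)
qed

lemma adjoint_pair_cadjoint:
  fixes A :: "'a::complex_hilbert_space \<Rightarrow> 'a"
  assumes "A \<in> bounded_operators"
  shows "adjoint_pair A (cadjoint A)"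
proof -
  have A: "bounded_linear A" and AC: "\<And>c x. A (c *\<^sub>C x) = c *\<^sub>C A x"
    using assms by (auto simp: bounded_operators_def)
  interpret A: bounded_linear A by (rule A)
  have bound: "norm (A x) \<le> onorm A * norm x" for x by (rule onorm[OF A])
  have "\<exists>z. \<forall>x. cinner (A x) y = cinner x z" for y
  proof -
    have "bounded_linear (\<lambda>x. Re (cinner (A x) y))"
    proof (rule bounded_linear_intro)
      show "norm (Re (cinner (A x) y)) \<le> norm x * (onorm A * norm y)" for x
        using abs_Re_cinner_le[of "A x" y] mult_right_mono[OF bound[of x], of "norm y"]
        by (simp add: mult.commute mult.left_commute)
    qed (simp_all add: A.add A.scaleR cinner_simps)
    then obtain z where z: "\<And>x. Re (cinner (A x) y) = Re (cinner x z)"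
      using riesz_representation_real by metis
    have "cinner (A x) y = cinner x z" for x
    proof (rule complex_eqI)
      \<comment> \<open>The imaginary part at \<open>x\<close> is minus the real part at \<open>\<i> x\<close>.\<close>
      show "Im (cinner (A x) y) = Im (cinner x z)"
        using z[of "\<i> *\<^sub>C x"] by (simp add: AC cinner_scaleC_left)
    qed (rule z)
    then show ?thesis by blast
  qed
  then obtain B where adj: "\<And>x y. cinner (A x) y = cinner x (B y)" by metis
  have add: "B (x + y) = B x + B y" for x y
    by (rule cinner_eqI) (simp add: adj[symmetric] cinner_add_right)
  have scaleC: "B (c *\<^sub>C x) = c *\<^sub>C B x" for c x
    by (rule cinner_eqI) (simp add: adj[symmetric] cinner_scaleC_right)
  have "bounded_linear B"
  proof (rule bounded_linear_intro)
    show "norm (B x) \<le> norm x * onorm A" for x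
      using formal_adjoint_norm_le[OF adj bound] by (simp add: mult.commute)
  qed (simp_all add: add scaleC scaleR_scaleC)
  then have "adjoint_pair A B"
    using assms by (simp add: adjoint_pair_def bounded_operators_def adj scaleC)
  then show ?thesis using adjoint_pair_cadjoint_eq by metis
qed

lemma selfadjoint_operators_iff: "A \<in> selfadjoint_operators \<longleftrightarrow> adjoint_pair A A"
proof
  assume "A \<in> selfadjoint_operators"
  then show "adjoint_pair A A"
    using adjoint_pair_cadjoint[of A] by (simp add: selfadjoint_operators_def)
next
  assume "adjoint_pair A A"
  then show "A \<in> selfadjoint_operators"
    using adjoint_pair_cadjoint_eq[of A A]
    by (simp add: selfadjoint_operators_def adjoint_pair_def)
qed

lemma scaleC_diff_right: "c *\<^sub>C (x - y) = c *\<^sub>C x - c *\<^sub>C (y::'a::complex_hilbert_space)"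
  using scaleC_add_right[of c "x - y" y] by (simp add: algebra_simps)

lemma scaleC_scaleR: "c *\<^sub>C r *\<^sub>R x = r *\<^sub>R c *\<^sub>C (x::'a::complex_hilbert_space)"
  by (simp add: scaleR_scaleC scaleC_scaleC mult.commute)

lemma adjoint_pair_compose:
  assumes "adjoint_pair A A'" "adjoint_pair B B'"
  shows "adjoint_pair (\<lambda>x. A (B x)) (\<lambda>x. B' (A' x))"
  using assms unfolding adjoint_pair_def bounded_operators_def
  by (auto intro: bounded_linear_compose)

lemma adjoint_pair_add:
  assumes "adjoint_pair A A'" "adjoint_pair B B'"
  shows "adjoint_pair (\<lambda>x. A x + B x) (\<lambda>x. A' x + B' x)"
  using assms unfolding adjoint_pair_def bounded_operators_def
  by (auto intro: bounded_linear_add simp: cinner_simps scaleC_add_right)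

lemma adjoint_pair_diff:
  assumes "adjoint_pair A A'" "adjoint_pair B B'"
  shows "adjoint_pair (\<lambda>x. A x - B x) (\<lambda>x. A' x - B' x)"
  using assms unfolding adjoint_pair_def bounded_operators_def
  by (auto intro: bounded_linear_sub simp: cinner_simps scaleC_diff_right)

lemma adjoint_pair_scaleR:
  assumes "adjoint_pair A A'"
  shows "adjoint_pair (\<lambda>x. r *\<^sub>R A x) (\<lambda>x. r *\<^sub>R A' x)"
  using assms unfolding adjoint_pair_def bounded_operators_def
  by (auto intro: bounded_linear_const_scaleR simp: cinner_simps scaleC_scaleR)

lemma adjoint_pair_ident: "adjoint_pair (\<lambda>x. x) (\<lambda>x. x)"
  by (simp add: adjoint_pair_def bounded_operators_def)

lemmas adjoint_pair_intros = adjoint_pair_add adjoint_pair_diff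
  adjoint_pair_scaleR adjoint_pair_ident

section \<open>Completing a column to a self-adjoint operator\<close>

text \<open>
  Relative to the decomposition given by the projection \<open>Q\<close>, the operator in question is
  the block matrix with rows \<open>(a, c\<^sup>*)\<close> and \<open>(c, - c a c\<^sup>* / m\<^sup>2)\<close>. Krein's
  extension theorem would provide a corner preserving the norm of the column \<open>(a, c)\<close>, at the
  price of square roots or inverses of operators. The hypothesis bounds the column \<open>(2a, c)\<close>
  instead, and this slack makes the polynomial corner \<open>- c a c\<^sup>* / m\<^sup>2\<close> sufficient. It is
  the lowest-order term in \<open>a\<close> of Krein's corner \<open>- c a (m\<^sup>2 - a\<^sup>2)\<^sup>-\<^sup>1 c\<^sup>*\<close>.
\<close>

lemma selfadjoint_completion_norm_le:
  fixes Q a c cs :: "'a::complex_hilbert_space \<Rightarrow> 'a"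
  assumes Q: "adjoint_pair Q Q" "\<And>x. Q (Q x) = Q x"
    and a: "adjoint_pair a a" "\<And>x. a (Q x) = a x" "\<And>x. Q (a x) = a x"
    and c: "adjoint_pair c cs" "\<And>x. c (Q x) = c x" "\<And>x. Q (c x) = 0"
    and column: "\<And>x. 4 * (norm (a x))\<^sup>2 + (norm (c x))\<^sup>2 \<le> m\<^sup>2 * (norm x)\<^sup>2"
    and m: "0 < m"
  shows "norm (a z + c z + cs z - (1 / m\<^sup>2) *\<^sub>R c (a (cs z))) \<le> m * norm z"
proof -
  interpret a: bounded_linear a using adjoint_pair_bounded_linear[OF a(1)] by blast
  interpret c: bounded_linear c using adjoint_pair_bounded_linear[OF c(1)] by blast
  interpret cs: bounded_linear cs using adjoint_pair_bounded_linear[OF c(1)] by blast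
  have Qcs: "Q (cs x) = cs x" for x
    by (rule cinner_eqI) (simp add: adjoint_pairD[OF Q(1), symmetric]
        adjoint_pairD[OF c(1), symmetric] c)
  have csQ: "cs (Q x) = 0" for x
  proof (rule cinner_eqI)
    fix y
    have "cinner y (cs (Q x)) = cinner (Q (c y)) x"
      by (simp add: adjoint_pairD[OF Q(1)] adjoint_pairD[OF c(1)])
    also have "\<dots> = cinner y 0"
      using c(3) cinner_diff_left[of 0 0 x] cinner_diff_right[of y 0 0] by simp
    finally show "cinner y (cs (Q x)) = cinner y 0" .
  qed
  have zero: "cinner 0 x = 0" for x :: 'a
    using cinner_diff_left[of 0 0 x] by simp
  have orth: "cinner (Q x) y = 0" if "Q y = 0" for x y
    using that adjoint_pairD[OF Q(1), of y x] zero cinner_commute[of y "Q x"]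
      adjoint_pairD[OF Q(1), of x y] cinner_diff_right[of x 0 0] by simp
  define x where "x = Q z"
  define y where "y = z - Q z"
  define u where "u = cs y"
  \<comment> \<open>Both terms with \<open>c\<close> combine to \<open>c (x - f)\<close>, so the column bound applies to \<open>x - f\<close>.\<close>
  define f where "f = (1 / m\<^sup>2) *\<^sub>R a u"
  have csz: "cs z = u" by (simp add: u_def y_def cs.diff csQ)
  have af: "a f = (1 / m\<^sup>2) *\<^sub>R a (a u)" by (simp add: f_def a.scaleR)
  have Qu: "Q u = u" by (simp add: u_def Qcs)
  have Qadd: "Q (p + q) = Q p + Q q" "Q (p - q) = Q p - Q q" for p q
    using adjoint_pair_bounded_linear[OF Q(1)]
    by (simp_all add: linear_simps)
  have m2: "0 < m\<^sup>2" using m by simp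
  have au: "(norm (a u))\<^sup>2 / m\<^sup>2 = m\<^sup>2 * (norm f)\<^sup>2"
  proof -
    have "a u = m\<^sup>2 *\<^sub>R f" using m by (simp add: f_def)
    then show ?thesis using m by (simp add: power_mult_distrib power2_eq_square)
  qed
  \<comment> \<open>The column bound at \<open>u = c\<^sup>* y\<close> makes \<open>c\<^sup>*\<close> a contraction up to \<open>m\<close>, with a surplus in \<open>f\<close>.\<close>
  have u_bound: "(norm u)\<^sup>2 + 4 * (m\<^sup>2 * (norm f)\<^sup>2) \<le> m\<^sup>2 * (norm y)\<^sup>2"
  proof -
    have "(norm u)\<^sup>2 = Re (cinner (c u) y)"
      by (simp add: power2_norm_eq_cinner adjoint_pairD[OF c(1)] u_def)
    also have "\<dots> \<le> norm (c u) * norm y" by (rule Re_cinner_le)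
    finally have 1: "(norm u)\<^sup>2 \<le> norm (c u) * norm y" .
    have "0 \<le> (norm (c u) / m - m * norm y)\<^sup>2" by simp
    then have "2 * (norm (c u) * norm y) \<le> (norm (c u))\<^sup>2 / m\<^sup>2 + m\<^sup>2 * (norm y)\<^sup>2"
      using m by (simp add: power2_diff power_divide power_mult_distrib)
    moreover have "(4 * (norm (a u))\<^sup>2 + (norm (c u))\<^sup>2) / m\<^sup>2 \<le> (norm u)\<^sup>2"
      using column[of u] m2 by (simp add: divide_le_eq mult.commute)
    then have "4 * (m\<^sup>2 * (norm f)\<^sup>2) + (norm (c u))\<^sup>2 / m\<^sup>2 \<le> (norm u)\<^sup>2"
      using au by (simp add: add_divide_distrib)
    ultimately show ?thesis using 1 by linarith
  qed
  \<comment> \<open>Here the slack enters: the column bound gives \<open>\<parallel>a f\<parallel> \<le> m \<parallel>f\<parallel> / 2\<close>.\<close>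
  have ax_bound: "(norm (a x))\<^sup>2 \<le> 3 * (m\<^sup>2 * (norm f)\<^sup>2) + 4 * (norm (a x - a f))\<^sup>2"
  proof -
    have "(norm (a f))\<^sup>2 \<le> m\<^sup>2 * (norm f)\<^sup>2 / 4"
      using column[of f] zero_le_power2[of "norm (c f)"] by linarith
    moreover have "(norm (a x))\<^sup>2 \<le> 2 * (norm (a x - a f))\<^sup>2 + 2 * (norm (a f))\<^sup>2"
    proof -
      have "0 \<le> (norm ((a x - a f) - a f))\<^sup>2" by simp
      moreover have "(norm (a x))\<^sup>2 = (norm ((a x - a f) + a f))\<^sup>2" by simp
      ultimately show ?thesis
        unfolding power2_norm_add[of "a x - a f"] power2_norm_diff[of "a x - a f" "a f"]
        by linarith
    qed
    moreover have "0 \<le> (norm (a x - a f))\<^sup>2" "0 \<le> m\<^sup>2 * (norm f)\<^sup>2" by simp_all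
    ultimately show ?thesis by linarith
  qed
  \<comment> \<open>By this identity the cross terms of \<open>\<parallel>a x + u\<parallel>\<^sup>2\<close> and \<open>m\<^sup>2 \<parallel>x - f\<parallel>\<^sup>2\<close> cancel.\<close>
  have cross: "Re (cinner (a x) u) = m\<^sup>2 * Re (cinner x f)"
    using m by (simp add: adjoint_pairD[OF a(1)] f_def cinner_scaleR_right)
  have "a z + c z + cs z - (1 / m\<^sup>2) *\<^sub>R c (a (cs z)) = (a x + u) + c (x - f)"
    by (simp add: csz x_def a(2) c(2) c.diff f_def c.scaleR)
  also have "(norm \<dots>)\<^sup>2 = (norm (a x + u))\<^sup>2 + (norm (c (x - f)))\<^sup>2"
  proof -
    have "cinner (a x + u) (c (x - f)) = 0"
      using orth[OF c(3), of "a x + u"] by (simp add: Qadd a(3) Qu)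
    then show ?thesis by (simp add: power2_norm_add[of "a x + u"])
  qed
  also have "\<dots> \<le> (norm (a x + u))\<^sup>2 + m\<^sup>2 * (norm (x - f))\<^sup>2 - 4 * (norm (a x - a f))\<^sup>2"
    using column[of "x - f"] by (simp add: a.diff)
  also have "\<dots> = (norm (a x))\<^sup>2 + (norm u)\<^sup>2 + m\<^sup>2 * (norm x)\<^sup>2 + m\<^sup>2 * (norm f)\<^sup>2
      - 4 * (norm (a x - a f))\<^sup>2"
    unfolding power2_norm_add[of "a x"] power2_norm_diff[of x] cross by (simp add: algebra_simps)
  also have "\<dots> \<le> m\<^sup>2 * (norm x)\<^sup>2 + m\<^sup>2 * (norm y)\<^sup>2"
    using u_bound ax_bound by linarith
  also have "\<dots> = (m * norm z)\<^sup>2"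
  proof -
    have "cinner x y = 0"
      unfolding x_def by (rule orth) (simp add: y_def Qadd Q(2))
    then have "(norm (x + y))\<^sup>2 = (norm x)\<^sup>2 + (norm y)\<^sup>2"
      by (simp add: power2_norm_add)
    then show ?thesis by (simp add: x_def y_def power_mult_distrib algebra_simps)
  qed
  finally show ?thesis
    by (rule power2_le_imp_le) (use m in simp)
qed

section \<open>Lifting a tangent vector\<close>

text \<open>
  The value of \<open>A V\<close> asked for is half of \<open>Q w P\<close> plus all of \<open>(1 - Q) w P\<close>, where
  \<open>w = X V - V Y\<close>. With \<open>(a, c)\<close> the corresponding column of \<open>A\<close>, the operator \<open>w V\<^sup>*\<close> is
  exactly \<open>2 a + c\<close>, with orthogonal ranges, so its bound \<open>m\<close> is the hypothesis
  of the completion lemma.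
\<close>

lemma half_lift:
  fixes V W X Y :: "'a::complex_hilbert_space \<Rightarrow> 'a"
  assumes V: "adjoint_pair V W" and VWV: "\<And>x. V (W (V x)) = V x"
    and X: "adjoint_pair X X" and Y: "adjoint_pair Y Y"
    and bound: "\<And>x. norm (X (V x) - V (Y x)) \<le> m * norm x"
    and W_contraction: "\<And>x. norm (W x) \<le> norm x"
    and m: "0 < m"
  obtains A where "adjoint_pair A A" "\<And>x. norm (A x) \<le> m * norm x"
    "\<And>x. A (V x) = (1 / 2) *\<^sub>R (V (W (X (V x))) - V (Y (W (V x))))
      + (X (V x) - V (W (X (V x))))"
proof -
  note W = adjoint_pair_sym[OF V]
  interpret V: bounded_linear V using adjoint_pair_bounded_linear[OF V] by blast
  interpret W: bounded_linear W using adjoint_pair_bounded_linear[OF V] by blast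
  interpret X: bounded_linear X using adjoint_pair_bounded_linear[OF X] by blast
  interpret Y: bounded_linear Y using adjoint_pair_bounded_linear[OF Y] by blast
  have WVW: "W (V (W x)) = W x" for x
    by (rule cinner_eqI) (simp add: adjoint_pairD[OF V, symmetric]
        adjoint_pairD[OF W, symmetric] VWV)
  define Q where "Q x = V (W x)" for x
  define a where "a x = (1 / 2) *\<^sub>R (V (W (X (V (W x)))) - V (Y (W x)))" for x
  define c where "c x = X (V (W x)) - V (W (X (V (W x))))" for x
  define cs where "cs x = V (W (X x)) - V (W (X (V (W x))))" for x
  have Q': "adjoint_pair Q Q"
    unfolding Q_def by (intro adjoint_pair_intros adjoint_pair_compose[OF V] adjoint_pair_compose[OF W])
  have a': "adjoint_pair a a"
    unfolding a_def
    by (intro adjoint_pair_intros adjoint_pair_compose[OF V] adjoint_pair_compose[OF W]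
        adjoint_pair_compose[OF X] adjoint_pair_compose[OF Y])
  have c': "adjoint_pair c cs"
    unfolding c_def cs_def
    by (intro adjoint_pair_intros adjoint_pair_compose[OF V] adjoint_pair_compose[OF W]
        adjoint_pair_compose[OF X])
  have column: "4 * (norm (a x))\<^sup>2 + (norm (c x))\<^sup>2 \<le> m\<^sup>2 * (norm x)\<^sup>2" for x
  proof -
    have "cinner (2 *\<^sub>R a x) (c x) = 0"
    proof -
      have "2 *\<^sub>R a x = V (W (2 *\<^sub>R a x))"
        by (simp add: a_def V.diff W.diff VWV)
      moreover have "W (c x) = 0" by (simp add: c_def W.diff WVW)
      ultimately show ?thesis
        by (metis V adjoint_pairD cinner_diff_right diff_self)
    qed
    then have "(norm (2 *\<^sub>R a x + c x))\<^sup>2 = 4 * (norm (a x))\<^sup>2 + (norm (c x))\<^sup>2"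
      by (simp add: power2_norm_add power_mult_distrib)
    moreover have "2 *\<^sub>R a x + c x = X (V (W x)) - V (Y (W x))"
      by (simp add: a_def c_def)
    moreover have "norm (X (V (W x)) - V (Y (W x))) \<le> m * norm x"
      using bound[of "W x"] mult_left_mono[OF W_contraction[of x], of m] m by linarith
    ultimately show ?thesis by (metis norm_ge_zero power_mono power_mult_distrib)
  qed
  define A where "A x = a x + c x + cs x - (1 / m\<^sup>2) *\<^sub>R c (a (cs x))" for x
  show thesis
  proof (rule that)
    have "adjoint_pair A (\<lambda>x. a x + cs x + c x - (1 / m\<^sup>2) *\<^sub>R c (a (cs x)))"
      unfolding A_def
      by (intro adjoint_pair_intros adjoint_pair_compose[OF a'] adjoint_pair_compose[OF c']
          adjoint_pair_compose[OF adjoint_pair_sym[OF c']])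
    then show "adjoint_pair A A"
      by (simp add: A_def[abs_def] add_ac)
    show "norm (A x) \<le> m * norm x" for x
      unfolding A_def
    proof (rule selfadjoint_completion_norm_le[OF Q' _ a' _ _ c' _ _ column m])
      show "Q (Q x) = Q x" for x by (simp add: Q_def VWV)
      show "a (Q x) = a x" for x by (simp add: Q_def a_def WVW)
      show "Q (a x) = a x" for x
        by (simp add: Q_def a_def V.scaleR W.scaleR V.diff W.diff VWV)
      show "c (Q x) = c x" for x by (simp add: Q_def c_def WVW)
      show "Q (c x) = 0" for x by (simp add: Q_def c_def V.diff W.diff VWV)
    qed
    have "cs (V x) = 0" for x by (simp add: cs_def VWV)
    moreover have "a 0 = 0" "c 0 = 0" by (simp_all add: a_def c_def)
    ultimately show "A (V x) = (1 / 2) *\<^sub>R (V (W (X (V x))) - V (Y (W (V x))))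
        + (X (V x) - V (W (X (V x))))" for x
      by (simp add: A_def a_def c_def VWV)
  qed
qed

text \<open>
  Since \<open>V\<^sup>* V\<close> is idempotent, \<open>V\<^sup>*\<close> is isometric on the range of \<open>V\<close>. Thus
  \<open>\<parallel>V x\<parallel>\<^sup>2 = \<langle>x, V\<^sup>* V x\<rangle> \<le> \<parallel>x\<parallel> \<parallel>V x\<parallel>\<close>.
\<close>

lemma partial_isometry_norm_le:
  fixes V W :: "'a::complex_hilbert_space \<Rightarrow> 'a"
  assumes V: "adjoint_pair V W" and VWV: "\<And>x. V (W (V x)) = V x"
  shows "norm (V x) \<le> norm x"
proof -
  have "cinner (V x) (V x) = cinner (W (V x)) (W (V x))"
    using VWV by (metis V adjoint_pairD adjoint_pair_sym)
  then have eq: "norm (W (V x)) = norm (V x)" by (simp add: norm_eq_sqrt_cinner)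
  have "(norm (V x))\<^sup>2 = Re (cinner x (W (V x)))"
    by (simp add: power2_norm_eq_cinner adjoint_pairD[OF V])
  also have "\<dots> \<le> norm x * norm (V x)"
    using Re_cinner_le[of x "W (V x)"] eq by simp
  finally show ?thesis
    by (cases "V x = 0") (simp_all add: power2_eq_square)
qed

text \<open>
  The operator \<open>B\<close> comes from \<open>half_lift\<close> with \<open>V\<close> exchanged for \<open>V\<^sup>*\<close> and \<open>X\<close> for \<open>Y\<close>: the
  tangent expression then becomes \<open>Y V\<^sup>* - V\<^sup>* X = - w\<^sup>*\<close>, which obeys the same bound, and the
  minus sign makes the halves of \<open>Q w P\<close> add up in \<open>A V - V B\<close>.
\<close>

lemma tangent_lift:
  fixes V W X Y :: "'a::complex_hilbert_space \<Rightarrow> 'a"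
  assumes V: "adjoint_pair V W" and VWV: "\<And>x. V (W (V x)) = V x"
    and X: "adjoint_pair X X" and Y: "adjoint_pair Y Y"
    and bound: "\<And>x. norm (X (V x) - V (Y x)) \<le> m * norm x"
    and m: "0 < m"
  obtains A B where "adjoint_pair A A" "adjoint_pair B B"
    "\<And>x. norm (A x) \<le> m * norm x" "\<And>x. norm (B x) \<le> m * norm x"
    "\<And>x. A (V x) - V (B x) = X (V x) - V (Y x)"
proof -
  note W = adjoint_pair_sym[OF V]
  interpret V: bounded_linear V using adjoint_pair_bounded_linear[OF V] by blast
  have WVW: "W (V (W x)) = W x" for x
    by (rule cinner_eqI) (simp add: adjoint_pairD[OF V, symmetric]
        adjoint_pairD[OF W, symmetric] VWV)
  obtain A where A: "adjoint_pair A A" "\<And>x. norm (A x) \<le> m * norm x"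
    and AV: "\<And>x. A (V x) = (1 / 2) *\<^sub>R (V (W (X (V x))) - V (Y (W (V x))))
      + (X (V x) - V (W (X (V x))))"
    using half_lift[OF V VWV X Y bound partial_isometry_norm_le[OF W WVW] m] by blast
  have "adjoint_pair (\<lambda>x. X (V x) - V (Y x)) (\<lambda>x. W (X x) - Y (W x))"
    by (intro adjoint_pair_intros adjoint_pair_compose[OF V]
        adjoint_pair_compose[OF X] adjoint_pair_compose[OF Y])
  from formal_adjoint_norm_le[OF adjoint_pairD[OF this] bound]
  have "norm (W (X x) - Y (W x)) \<le> m * norm x" for x .
  then have bound': "norm (Y (W x) - W (X x)) \<le> m * norm x" for x
    by (simp add: norm_minus_commute)
  obtain B where B: "adjoint_pair B B" "\<And>x. norm (B x) \<le> m * norm x"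
    and BW: "\<And>x. B (W x) = (1 / 2) *\<^sub>R (W (V (Y (W x))) - W (X (V (W x))))
      + (Y (W x) - W (V (Y (W x))))"
    using half_lift[OF W WVW Y X bound' partial_isometry_norm_le[OF V VWV] m] by blast
  \<comment> \<open>This is the adjoint of \<open>BW\<close>.\<close>
  have VB: "V (B x) = (1 / 2) *\<^sub>R (V (Y (W (V x))) - V (W (X (V x))))
      + (V (Y x) - V (Y (W (V x))))" for x
  proof -
    have "adjoint_pair (\<lambda>x. V (B x)) (\<lambda>x. B (W x))"
      by (rule adjoint_pair_compose[OF V B(1)])
    moreover have "adjoint_pair (\<lambda>x. B (W x))
        (\<lambda>x. (1 / 2) *\<^sub>R (V (Y (W (V x))) - V (W (X (V x)))) + (V (Y x) - V (Y (W (V x)))))"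
      unfolding BW
      by (intro adjoint_pair_intros adjoint_pair_compose[OF V] adjoint_pair_compose[OF W]
          adjoint_pair_compose[OF X] adjoint_pair_compose[OF Y])
    ultimately show ?thesis
      by (metis (no_types, lifting) adjoint_pair_cadjoint_eq adjoint_pair_sym)
  qed
  have "A (V x) - V (B x) = X (V x) - V (Y x)" for x
  proof -
    have halves: "(1 / 2) *\<^sub>R (p - q) - (1 / 2) *\<^sub>R (q - p) = p - q" for p q :: 'a
    proof -
      have "(1 / 2) *\<^sub>R (p - q) - (1 / 2) *\<^sub>R (q - p) = (1 / 2) *\<^sub>R ((p - q) - (q - p))"
        by (simp only: scaleR_diff_right)
      also have "(p - q) - (q - p) = (p - q) + (p - q)" by simp
      finally show ?thesis by (simp only: scaleR_half_double)
    qed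
    show ?thesis
      using halves[of "V (W (X (V x)))" "V (Y (W (V x)))"]
      unfolding AV VB by (simp add: algebra_simps)
  qed
  then show thesis using that A B by blast
qed

section \<open>Comparison of the norms\<close>

theorem theorem5p4:
  fixes V v :: "'a::complex_hilbert_space \<Rightarrow> 'a"
  assumes "V \<in> partial_isometries"
    and "v \<in> tangent_space V"
  shows "finsler_norm V v \<le> onorm v \<and> onorm v \<le> 2 * finsler_norm V v"
proof -
  define W where "W = cadjoint V"
  have V: "adjoint_pair V W"
    using assms(1) by (auto simp: partial_isometries_def W_def intro: adjoint_pair_cadjoint)
  have VWV: "V (W (V x)) = V x" for x
    using assms(1) by (auto simp: partial_isometries_def W_def o_def dest: fun_cong)
  obtain X Y where X: "adjoint_pair X X" and Y: "adjoint_pair Y Y"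
    and v: "v = (\<lambda>x. \<i> *\<^sub>C X (V x) - \<i> *\<^sub>C V (Y x))"
    using assms(2) by (auto simp: tangent_space_def selfadjoint_operators_iff)
  define S where "S = {max (onorm A) (onorm B) | A B.
    A \<in> selfadjoint_operators \<and> B \<in> selfadjoint_operators \<and>
    (\<lambda>x. \<i> *\<^sub>C A (V x) - \<i> *\<^sub>C V (B x)) = v}"
  have finsler: "finsler_norm V v = Inf S" by (simp add: finsler_norm_def S_def)
  have norm_v: "norm (v x) = norm (X (V x) - V (Y x))" for x
    by (simp add: v norm_scaleC_ii flip: scaleC_diff_right)
  have "adjoint_pair (\<lambda>x. X (V x) - V (Y x)) (\<lambda>x. W (X x) - Y (W x))"
    by (intro adjoint_pair_intros adjoint_pair_compose[OF V]
        adjoint_pair_compose[OF X] adjoint_pair_compose[OF Y])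
  then have "bounded_linear (\<lambda>x. X (V x) - V (Y x))"
    by (rule adjoint_pair_bounded_linear)
  moreover have "onorm v = onorm (\<lambda>x. X (V x) - V (Y x))"
    by (simp add: onorm_def norm_v)
  ultimately have v_bound: "norm (X (V x) - V (Y x)) \<le> onorm v * norm x"
    and v_nonneg: "0 \<le> onorm v" for x
    using onorm onorm_pos_le by metis+
  have bdd: "bdd_below S"
    unfolding S_def by (rule bdd_belowI[of _ 0])
      (auto simp: selfadjoint_operators_iff
        intro!: max.coboundedI1 onorm_pos_le intro: adjoint_pair_bounded_linear)
  have "finsler_norm V v \<le> onorm v"
  proof (rule dense_ge)
    \<comment> \<open>Working above \<open>onorm v\<close> keeps \<open>m\<close> positive when \<open>v = 0\<close>.\<close>
    fix m assume "onorm v < m"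
    then have "0 < m" and "norm (X (V x) - V (Y x)) \<le> m * norm x" for x
      using v_nonneg v_bound[of x] mult_right_mono[of "onorm v" m "norm x"] by auto
    then obtain A B where AB: "adjoint_pair A A" "adjoint_pair B B"
      "\<And>x. norm (A x) \<le> m * norm x" "\<And>x. norm (B x) \<le> m * norm x"
      "\<And>x. A (V x) - V (B x) = X (V x) - V (Y x)"
      using tangent_lift[OF V VWV X Y] by metis
    have "(\<lambda>x. \<i> *\<^sub>C A (V x) - \<i> *\<^sub>C V (B x)) = v"
      by (simp add: v AB(5) flip: scaleC_diff_right)
    then have "max (onorm A) (onorm B) \<in> S"
      using AB unfolding S_def selfadjoint_operators_iff by blast
    then have "Inf S \<le> max (onorm A) (onorm B)" using bdd by (rule cInf_lower)
    also have "\<dots> \<le> m"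
      using AB \<open>0 < m\<close> by (auto intro!: onorm_bound)
    finally show "finsler_norm V v \<le> m" by (simp add: finsler)
  qed
  moreover have "onorm v / 2 \<le> Inf S"
  proof (rule cInf_greatest)
    show "S \<noteq> {}"
      using X Y v unfolding S_def selfadjoint_operators_iff by blast
  next
    fix r assume "r \<in> S"
    then obtain A B where A: "adjoint_pair A A" and B: "adjoint_pair B B"
      and r: "r = max (onorm A) (onorm B)"
      and v': "v = (\<lambda>x. \<i> *\<^sub>C A (V x) - \<i> *\<^sub>C V (B x))"
      unfolding S_def selfadjoint_operators_iff by blast
    have A': "bounded_linear A" and B': "bounded_linear B"
      using A B adjoint_pair_bounded_linear by blast+
    note contraction = partial_isometry_norm_le[OF V VWV]
    have "norm (v x) \<le> (2 * r) * norm x" for x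
    proof -
      have "norm (v x) \<le> norm (A (V x)) + norm (V (B x))"
        unfolding v' using norm_triangle_ineq4 norm_scaleC_ii by metis
      also have "norm (A (V x)) \<le> onorm A * norm x"
        using onorm[OF A', of "V x"] mult_left_mono[OF contraction[of x] onorm_pos_le[OF A']]
        by linarith
      also have "norm (V (B x)) \<le> onorm B * norm x"
        using contraction[of "B x"] onorm[OF B', of x] by linarith
      also have "onorm A * norm x + onorm B * norm x \<le> (2 * r) * norm x"
        unfolding distrib_right[symmetric] by (rule mult_right_mono) (auto simp: r)
      finally show ?thesis by simp
    qed
    moreover have "0 \<le> r" using onorm_pos_le[OF A'] by (simp add: r le_max_iff_disj)
    ultimately show "onorm v / 2 \<le> r"
      using onorm_bound[of "2 * r" v] by simp
  qed
  ultimately show ?thesis by (simp add: finsler)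
qed

end
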